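(* Let $\beta\in\Omega^1(S^1)$ be a one-form with nondegenerate zeros and nonempty zero set, and let $a\in\mathbb R\setminus\{0\}$. Then the two-form $\Omega\in\Omega^2(\operatorname{Emb}_a(S^1,\mathbb R^2))$ defined by $$\Omega_f(u_f,v_f)=\int_{S^1}\omega(u_f,v_f)\,\beta,\qquad f\in\operatorname{Emb}_a(S^1,\mathbb R^2),\ u_f,v_f\in T_f\operatorname{Emb}_a(S^1,\mathbb R^2),$$ is symplectic and exact.
   Context: $S^1=\mathbb R/2\pi\mathbb Z$ is the oriented circle. A one-form $\beta=b(t)\,dt$ has nondegenerate zeros if $b(t)=0$ implies $b'(t)\neq0$. On $\mathbb R^2$, $\omega=dx\wedge dy=d\nu$ with $\nu=\tfrac12(x\,dy-y\,dx)$. $\operatorname{Emb}_a(S^1,\mathbb R^2)$ is the Fréchet manifold of smooth embeddings $f:S^1\to\mathbb R^2$ enclosing fixed (signed) area $\int_{S^1}f^*\nu=a$, with tangent space $T_f\operatorname{Emb}_a(S^1,\mathbb R^2)=\{u_f:S^1\to\mathbb R^2\text{ smooth}\mid\int_{S^1}f^*\iota_{u_f}\omega=0\}$. In this infinite-dimensional setting, symplectic means closed and (weakly) nondegenerate: if $\Omega_f(u_f,v_f)=0$ for all $v_f\in T_f\operatorname{Emb}_a(S^1,\mathbb R^2)$, then $u_f=0$. *)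

theory Defs
  imports "HOL-Analysis.Analysis"
begin

section \<open>The Frechet space of smooth loops\<close>

definition curve_deriv :: "nat \<Rightarrow> (real \<Rightarrow> 'a::real_normed_vector) \<Rightarrow> real \<Rightarrow> 'a" where
  "curve_deriv k = (\<lambda>g t. vector_derivative g (at t)) ^^ k"

definition smooth_curve :: "(real \<Rightarrow> 'a::real_normed_vector) \<Rightarrow> bool" where
  "smooth_curve f \<longleftrightarrow> (\<forall>k. curve_deriv k f differentiable_on UNIV)"

lemma curve_deriv_0 [simp]: "curve_deriv 0 f = f"
  by (simp add: curve_deriv_def)

lemma curve_deriv_Suc: "curve_deriv (Suc k) f t = vector_derivative (curve_deriv k f) (at t)"
  by (simp add: curve_deriv_def)

lemma smooth_curve_has_deriv:
  "smooth_curve f \<Longrightarrow>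
    (curve_deriv k f has_vector_derivative curve_deriv (Suc k) f t) (at t)"
  unfolding smooth_curve_def curve_deriv_Suc
  by (simp add: differentiable_on_def vector_derivative_works[symmetric])

lemma smooth_curveI_seq:
  assumes "G 0 = f" and G: "\<And>k t. (G k has_vector_derivative G (Suc k) t) (at t)"
  shows "smooth_curve f" and "curve_deriv k f = G k"
proof -
  have *: "curve_deriv k f = G k" for k
  proof (induction k)
    case (Suc k)
    then show ?case
      using G vector_derivative_at by (metis curve_deriv_Suc ext)
  qed (use assms in simp)
  show "smooth_curve f"
    unfolding smooth_curve_def * differentiable_on_def
    using G by (auto intro: differentiableI_vector)
  show "curve_deriv k f = G k" by (rule *)
qed

lemma smooth_curve_lincomb:
  assumes "smooth_curve f" "smooth_curve g"
  shows "smooth_curve (\<lambda>t. c *\<^sub>R f t + d *\<^sub>R g t)"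
    and "curve_deriv k (\<lambda>t. c *\<^sub>R f t + d *\<^sub>R g t) =
          (\<lambda>t. c *\<^sub>R curve_deriv k f t + d *\<^sub>R curve_deriv k g t)"
proof -
  define G where "G = (\<lambda>k t. c *\<^sub>R curve_deriv k f t + d *\<^sub>R curve_deriv k g t)"
  have 0: "G 0 = (\<lambda>t. c *\<^sub>R f t + d *\<^sub>R g t)"
    by (simp add: G_def)
  have 1: "(G k has_vector_derivative G (Suc k) t) (at t)" for k t
    unfolding G_def
    by (intro has_vector_derivative_add
        bounded_linear.has_vector_derivative[OF bounded_linear_scaleR_right]
        smooth_curve_has_deriv assms)
  show "smooth_curve (\<lambda>t. c *\<^sub>R f t + d *\<^sub>R g t)"
    by (rule smooth_curveI_seq[OF 0 1])
  show "curve_deriv k (\<lambda>t. c *\<^sub>R f t + d *\<^sub>R g t) =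
          (\<lambda>t. c *\<^sub>R curve_deriv k f t + d *\<^sub>R curve_deriv k g t)"
    using smooth_curveI_seq(2)[OF 0 1, of k] unfolding G_def .
qed

text \<open>
  Smooth functions on the circle \<open>\<real>/2\<pi>\<int>\<close> are represented by \<open>2\<pi>\<close>-periodic smooth functions on
  the real line.  In particular \<open>real loop\<close> also represents the one-forms \<open>b(t) dt\<close> on the circle.
\<close>

typedef (overloaded) ('a::real_normed_vector) loop =
  "{f :: real \<Rightarrow> 'a. smooth_curve f \<and> (\<forall>t. f (t + 2 * pi) = f t)}"
  morphisms at_angle Loop
proof -
  have "smooth_curve (\<lambda>t. 0 :: 'a)"
    by (rule smooth_curveI_seq[where G = "\<lambda>k t. 0"]) auto
  then show ?thesis by blast
qed

setup_lifting type_definition_loop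

definition loop_deriv :: "nat \<Rightarrow> 'a::real_normed_vector loop \<Rightarrow> real \<Rightarrow> 'a" where
  "loop_deriv k f = curve_deriv k (at_angle f)"

instantiation loop :: (real_normed_vector) real_vector
begin

lift_definition zero_loop :: "'a loop" is "\<lambda>t. 0"
  by (auto intro: smooth_curveI_seq(1)[where G = "\<lambda>k t. 0"])

lift_definition plus_loop :: "'a loop \<Rightarrow> 'a loop \<Rightarrow> 'a loop" is "\<lambda>f g t. f t + g t"
  using smooth_curve_lincomb(1)[where c = 1 and d = 1] by auto

lift_definition minus_loop :: "'a loop \<Rightarrow> 'a loop \<Rightarrow> 'a loop" is "\<lambda>f g t. f t - g t"
  using smooth_curve_lincomb(1)[where c = 1 and d = "-1"] by auto

lift_definition uminus_loop :: "'a loop \<Rightarrow> 'a loop" is "\<lambda>f t. - f t"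
  using smooth_curve_lincomb(1)[where c = "-1" and d = 0] by auto

lift_definition scaleR_loop :: "real \<Rightarrow> 'a loop \<Rightarrow> 'a loop" is "\<lambda>c f t. c *\<^sub>R f t"
  using smooth_curve_lincomb(1)[where d = 0] by fastforce

instance
  by standard (transfer; simp add: algebra_simps)+

end

text \<open>
  The \<open>C\<^sup>\<infinity>\<close> topology, generated by the seminorms
  \<open>sup\<^sub>t \<parallel>f\<^sup>(\<^sup>j\<^sup>)(t)\<parallel>\<close> for \<open>j = 0, 1, 2, \<dots>\<close>.
\<close>

instantiation loop :: (real_normed_vector) topological_space
begin

definition open_loop :: "'a loop set \<Rightarrow> bool" where
  "open_loop U \<longleftrightarrow>
    (\<forall>f\<in>U. \<exists>k. \<exists>e>0. \<forall>g. (\<forall>j\<le>k. \<forall>t. norm (loop_deriv j g t - loop_deriv j f t) \<le> e) \<longrightarrow> g \<in> U)"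

instance
proof
  show "open (UNIV :: 'a loop set)"
    by (auto simp: open_loop_def intro: exI[of _ 1])
next
  fix S T :: "'a loop set"
  assume S: "open S" and T: "open T"
  show "open (S \<inter> T)"
    unfolding open_loop_def
  proof
    fix f assume f: "f \<in> S \<inter> T"
    obtain k1 e1 where 1: "e1 > 0"
      "\<And>g. (\<forall>j\<le>k1. \<forall>t. norm (loop_deriv j g t - loop_deriv j f t) \<le> e1) \<Longrightarrow> g \<in> S"
      using S f unfolding open_loop_def by blast
    obtain k2 e2 where 2: "e2 > 0"
      "\<And>g. (\<forall>j\<le>k2. \<forall>t. norm (loop_deriv j g t - loop_deriv j f t) \<le> e2) \<Longrightarrow> g \<in> T"
      using T f unfolding open_loop_def by blast
    show "\<exists>k. \<exists>e>0. \<forall>g. (\<forall>j\<le>k. \<forall>t. norm (loop_deriv j g t - loop_deriv j f t) \<le> e)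
            \<longrightarrow> g \<in> S \<inter> T"
      using 1 2 by (intro exI[of _ "max k1 k2"] exI[of _ "min e1 e2"]) auto
  qed
next
  fix K :: "'a loop set set"
  assume "\<forall>S\<in>K. open S"
  then show "open (\<Union>K)"
    unfolding open_loop_def by (meson Union_iff)
qed

end

section \<open>Differential forms in Frechet spaces and on their submanifolds\<close>

text \<open>
  Smoothness is meant in the usual sense for Frechet spaces (Michal-Bastiani, Hamilton): all iterated
  directional derivatives \<open>D\<^sup>kF(x){h\<^sub>0, \<dots>, h\<^sub>k\<^sub>-\<^sub>1}\<close> exist and are jointly continuous in
  \<open>(x, h\<^sub>0, \<dots>, h\<^sub>k\<^sub>-\<^sub>1)\<close>.  The directions form a sequence \<open>h\<close> carrying the product topology, of
  which \<open>iter_dir_deriv k\<close> only uses the first \<open>k\<close> entries.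
\<close>

definition dir_deriv :: "('e::real_vector \<Rightarrow> real) \<Rightarrow> 'e \<Rightarrow> 'e \<Rightarrow> real" where
  "dir_deriv F x h = deriv (\<lambda>s. F (x + s *\<^sub>R h)) 0"

primrec iter_dir_deriv :: "nat \<Rightarrow> ('e::real_vector \<Rightarrow> real) \<Rightarrow> 'e \<Rightarrow> (nat \<Rightarrow> 'e) \<Rightarrow> real" where
  "iter_dir_deriv 0 F x h = F x"
| "iter_dir_deriv (Suc k) F x h = dir_deriv (\<lambda>y. iter_dir_deriv k F y h) x (h k)"

definition smooth_fun_on :: "'e::{real_vector,topological_space} set \<Rightarrow> ('e \<Rightarrow> real) \<Rightarrow> bool" where
  "smooth_fun_on U F \<longleftrightarrow> open U \<and>
    (\<forall>k. (\<forall>x\<in>U. \<forall>h. (\<lambda>s. iter_dir_deriv k F (x + s *\<^sub>R h k) h) differentiable at 0) \<and>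
         continuous_on (U \<times> UNIV) (\<lambda>(x, h). iter_dir_deriv k F x h))"

definition one_form_on ::
    "'e::{real_vector,topological_space} set \<Rightarrow> ('e \<Rightarrow> 'e \<Rightarrow> real) \<Rightarrow> bool" where
  "one_form_on U \<theta> \<longleftrightarrow> open U \<and> (\<forall>x\<in>U. linear (\<theta> x)) \<and>
    smooth_fun_on (U \<times> UNIV) (\<lambda>(x, u). \<theta> x u)"

definition two_form_on ::
    "'e::{real_vector,topological_space} set \<Rightarrow> ('e \<Rightarrow> 'e \<Rightarrow> 'e \<Rightarrow> real) \<Rightarrow> bool" where
  "two_form_on U \<omega> \<longleftrightarrow> open U \<and> (\<forall>x\<in>U. bilinear (\<omega> x) \<and> (\<forall>u. \<omega> x u u = 0)) \<and>
    smooth_fun_on (U \<times> UNIV \<times> UNIV) (\<lambda>(x, u, v). \<omega> x u v)"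

definition ext_deriv1 :: "('e::real_vector \<Rightarrow> 'e \<Rightarrow> real) \<Rightarrow> 'e \<Rightarrow> 'e \<Rightarrow> 'e \<Rightarrow> real" where
  "ext_deriv1 \<theta> x u v = dir_deriv (\<lambda>y. \<theta> y v) x u - dir_deriv (\<lambda>y. \<theta> y u) x v"

definition ext_deriv2 ::
    "('e::real_vector \<Rightarrow> 'e \<Rightarrow> 'e \<Rightarrow> real) \<Rightarrow> 'e \<Rightarrow> 'e \<Rightarrow> 'e \<Rightarrow> 'e \<Rightarrow> real" where
  "ext_deriv2 \<omega> x u v w =
     dir_deriv (\<lambda>y. \<omega> y v w) x u - dir_deriv (\<lambda>y. \<omega> y u w) x v + dir_deriv (\<lambda>y. \<omega> y u v) x w"

text \<open>
  Let \<open>M\<close> be a (split) submanifold of a Frechet space with tangent spaces \<open>T f\<close>.  A form on \<open>M\<close> is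
  only meaningful at points \<open>f \<in> M\<close> and on vectors in \<open>T f\<close>.  It is smooth iff it locally extends
  to a smooth form on an open subset of the ambient space, and, exterior differentiation being
  natural under pullback by the inclusion \<open>M \<hookrightarrow> E\<close>, its exterior derivative is
  the restriction of the exterior derivative of any local extension (independently of the extension).
\<close>

definition extends_two_form ::
    "'e::{real_vector,topological_space} set \<Rightarrow> ('e \<Rightarrow> 'e set) \<Rightarrow> ('e \<Rightarrow> 'e \<Rightarrow> 'e \<Rightarrow> real) \<Rightarrow>
     'e set \<Rightarrow> ('e \<Rightarrow> 'e \<Rightarrow> 'e \<Rightarrow> real) \<Rightarrow> bool" where
  "extends_two_form M T \<Omega> U \<omega> \<longleftrightarrow>
     two_form_on U \<omega> \<and> (\<forall>f\<in>M \<inter> U. \<forall>u\<in>T f. \<forall>v\<in>T f. \<omega> f u v = \<Omega> f u v)"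

definition extends_one_form ::
    "'e::{real_vector,topological_space} set \<Rightarrow> ('e \<Rightarrow> 'e set) \<Rightarrow> ('e \<Rightarrow> 'e \<Rightarrow> real) \<Rightarrow>
     'e set \<Rightarrow> ('e \<Rightarrow> 'e \<Rightarrow> real) \<Rightarrow> bool" where
  "extends_one_form M T \<Theta> U \<theta> \<longleftrightarrow>
     one_form_on U \<theta> \<and> (\<forall>f\<in>M \<inter> U. \<forall>u\<in>T f. \<theta> f u = \<Theta> f u)"

definition is_one_form ::
    "'e::{real_vector,topological_space} set \<Rightarrow> ('e \<Rightarrow> 'e set) \<Rightarrow> ('e \<Rightarrow> 'e \<Rightarrow> real) \<Rightarrow> bool" where
  "is_one_form M T \<Theta> \<longleftrightarrow> (\<forall>f\<in>M. \<exists>U \<theta>. f \<in> U \<and> extends_one_form M T \<Theta> U \<theta>)"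

definition is_two_form ::
    "'e::{real_vector,topological_space} set \<Rightarrow> ('e \<Rightarrow> 'e set) \<Rightarrow> ('e \<Rightarrow> 'e \<Rightarrow> 'e \<Rightarrow> real) \<Rightarrow> bool" where
  "is_two_form M T \<Omega> \<longleftrightarrow> (\<forall>f\<in>M. \<exists>U \<omega>. f \<in> U \<and> extends_two_form M T \<Omega> U \<omega>)"

definition has_ext_deriv1 ::
    "'e::{real_vector,topological_space} set \<Rightarrow> ('e \<Rightarrow> 'e set) \<Rightarrow> ('e \<Rightarrow> 'e \<Rightarrow> real) \<Rightarrow>
     ('e \<Rightarrow> 'e \<Rightarrow> 'e \<Rightarrow> real) \<Rightarrow> bool" where
  "has_ext_deriv1 M T \<Theta> \<Omega> \<longleftrightarrow>
     (\<forall>f\<in>M. \<exists>U \<theta>. f \<in> U \<and> extends_one_form M T \<Theta> U \<theta> \<and>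
        (\<forall>g\<in>M \<inter> U. \<forall>u\<in>T g. \<forall>v\<in>T g. \<Omega> g u v = ext_deriv1 \<theta> g u v))"

definition has_ext_deriv2 ::
    "'e::{real_vector,topological_space} set \<Rightarrow> ('e \<Rightarrow> 'e set) \<Rightarrow> ('e \<Rightarrow> 'e \<Rightarrow> 'e \<Rightarrow> real) \<Rightarrow>
     ('e \<Rightarrow> 'e \<Rightarrow> 'e \<Rightarrow> 'e \<Rightarrow> real) \<Rightarrow> bool" where
  "has_ext_deriv2 M T \<Omega> \<Psi> \<longleftrightarrow>
     (\<forall>f\<in>M. \<exists>U \<omega>. f \<in> U \<and> extends_two_form M T \<Omega> U \<omega> \<and>
        (\<forall>g\<in>M \<inter> U. \<forall>u\<in>T g. \<forall>v\<in>T g. \<forall>w\<in>T g. \<Psi> g u v w = ext_deriv2 \<omega> g u v w))"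

definition closed_two_form where
  "closed_two_form M T \<Omega> \<longleftrightarrow> is_two_form M T \<Omega> \<and> has_ext_deriv2 M T \<Omega> (\<lambda>_ _ _ _. 0)"

definition exact_two_form where
  "exact_two_form M T \<Omega> \<longleftrightarrow>
     is_two_form M T \<Omega> \<and> (\<exists>\<Theta>. is_one_form M T \<Theta> \<and> has_ext_deriv1 M T \<Theta> \<Omega>)"

definition weakly_nondegenerate where
  "weakly_nondegenerate M T \<Omega> \<longleftrightarrow>
     (\<forall>f\<in>M. \<forall>u\<in>T f. (\<forall>v\<in>T f. \<Omega> f u v = 0) \<longrightarrow> u = 0)"

definition symplectic_form where
  "symplectic_form M T \<Omega> \<longleftrightarrow> closed_two_form M T \<Omega> \<and> weakly_nondegenerate M T \<Omega>"

section \<open>Embedded loops in the plane enclosing a fixed area\<close>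

definition area_form :: "real^2 \<Rightarrow> real^2 \<Rightarrow> real" where
  "area_form u v = u $ 1 * v $ 2 - u $ 2 * v $ 1"

text \<open>The primitive \<open>\<nu> = (x dy - y dx)/2\<close> of the area form, at the point \<open>p\<close>.\<close>

definition nu :: "real^2 \<Rightarrow> real^2 \<Rightarrow> real" where
  "nu p u = (p $ 1 * u $ 2 - p $ 2 * u $ 1) / 2"

definition circle_integral :: "(real \<Rightarrow> real) \<Rightarrow> real" where
  "circle_integral h = integral {0..2 * pi} h"

definition enclosed_area :: "(real^2) loop \<Rightarrow> real" where
  "enclosed_area f = circle_integral (\<lambda>t. nu (at_angle f t) (loop_deriv 1 f t))"

text \<open>The circle being compact, its embeddings are exactly its injective immersions.\<close>

definition is_embedding :: "(real^2) loop \<Rightarrow> bool" where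
  "is_embedding f \<longleftrightarrow>
     (\<forall>t. loop_deriv 1 f t \<noteq> 0) \<and>
     (\<forall>s t. at_angle f s = at_angle f t \<longrightarrow> (\<exists>n::int. t = s + of_int n * (2 * pi)))"

definition Emb :: "real \<Rightarrow> (real^2) loop set" where
  "Emb a = {f. is_embedding f \<and> enclosed_area f = a}"

text \<open>
  The integrand is \<open>f\<^sup>*(\<iota>\<^sub>u \<omega>)\<close>.  The left-hand side of the defining equation is the derivative of
  \<open>enclosed_area\<close> at \<open>f\<close> in direction \<open>u\<close>; it is a nonzero continuous functional of \<open>u\<close> because
  \<open>f\<close> is immersed.  Hence \<open>Emb a\<close> is a (split) submanifold of codimension one in the loop space.
\<close>

definition Emb_tangent :: "(real^2) loop \<Rightarrow> (real^2) loop set" where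
  "Emb_tangent f = {u. circle_integral (\<lambda>t. area_form (at_angle u t) (loop_deriv 1 f t)) = 0}"

text \<open>The one-form on the circle is \<open>\<beta> = b(t) dt\<close>.\<close>

definition weighted_form ::
    "real loop \<Rightarrow> (real^2) loop \<Rightarrow> (real^2) loop \<Rightarrow> (real^2) loop \<Rightarrow> real" where
  "weighted_form b f u v =
     circle_integral (\<lambda>t. area_form (at_angle u t) (at_angle v t) * at_angle b t)"

definition nondegenerate_zeros :: "real loop \<Rightarrow> bool" where
  "nondegenerate_zeros b \<longleftrightarrow> (\<forall>t. at_angle b t = 0 \<longrightarrow> loop_deriv 1 b t \<noteq> 0)"

end

theory Submission
  imports Defs
begin

text \<open>
  The form \<open>\<Omega>\<close> does not depend on the base point \<open>f\<close>: it is the restriction of a continuous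
  bilinear form on the whole Frechet space of loops.  Hence that space itself serves as the domain of
  all the required extensions.  A form with constant coefficients is closed, and half of its
  contraction with the position vector, \<open>\<Theta>\<^sub>f(u) = \<Omega>(f, u) / 2\<close>, is a primitive, just as
  \<open>\<nu>\<close> is one of \<open>dx \<and> dy\<close>.  As functions of the base point and the vectors together, both \<open>\<Omega>\<close>
  and \<open>\<Theta>\<close> have the form \<open>x \<mapsto> C(x, x)\<close> with \<open>C\<close> continuous bilinear, and for such functions all
  iterated directional derivatives can be written down (\<open>smooth_fun_on_quadratic\<close>).

  The content lies in the nondegeneracy.  If \<open>\<Omega>(u, v) = 0\<close> for all \<open>v\<close> tangent at \<open>f\<close>, that is, for
  all \<open>v\<close> annihilated by the functional \<open>v \<mapsto> \<integral>\<omega>(v, f') dt\<close>, then \<open>b u = \<lambda> f'\<close> for a Lagrange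
  multiplier \<open>\<lambda> \<in> \<real>\<close> (\<open>lagrange_multiplier\<close>).  At a zero of \<open>b\<close> this reads \<open>0 = \<lambda> f'\<close>, and \<open>f\<close> is an
  immersion, so the existence of a zero forces \<open>\<lambda> = 0\<close>.  Thus \<open>b u = 0\<close>, and \<open>u\<close> vanishes off the
  zeros of \<open>b\<close>; at a zero, differentiation gives \<open>b' u = 0\<close> with \<open>b' \<noteq> 0\<close>.
\<close>

section \<open>Operations on smooth loops\<close>

text \<open>
  The finite sums of products of derivatives of \<open>f\<close> and \<open>g\<close> are stable under differentiation, by the
  product rule; membership in this family replaces the explicit Leibniz formula for the higher
  derivatives.
\<close>

inductive derivative_product_sum ::
    "('a::real_normed_vector \<Rightarrow> 'b::real_normed_vector \<Rightarrow> 'c::real_normed_vector) \<Rightarrow>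
     (real \<Rightarrow> 'a) \<Rightarrow> (real \<Rightarrow> 'b) \<Rightarrow> (real \<Rightarrow> 'c) \<Rightarrow> bool"
  for p f g where
  product: "derivative_product_sum p f g (\<lambda>t. p (curve_deriv i f t) (curve_deriv j g t))"
| sum: "derivative_product_sum p f g F \<Longrightarrow> derivative_product_sum p f g G \<Longrightarrow>
    derivative_product_sum p f g (\<lambda>t. F t + G t)"

lemma derivative_product_sum_has_derivative:
  assumes "bounded_bilinear p" "smooth_curve f" "smooth_curve g" "derivative_product_sum p f g F"
  shows "\<exists>F'. derivative_product_sum p f g F' \<and> (\<forall>t. (F has_vector_derivative F' t) (at t))"
  using assms(4)
proof induction
  case (product i j)
  show ?case
    by (rule exI, rule conjI, rule derivative_product_sum.sum[OF
          derivative_product_sum.product[of p f g i "Suc j"]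
          derivative_product_sum.product[of p f g "Suc i" j]])
      (intro allI bounded_bilinear.has_vector_derivative[OF assms(1)] smooth_curve_has_deriv assms)
next
  case (sum F G)
  then obtain F' G' where
    "derivative_product_sum p f g F'" "\<forall>t. (F has_vector_derivative F' t) (at t)"
    "derivative_product_sum p f g G'" "\<forall>t. (G has_vector_derivative G' t) (at t)"
    by blast
  then show ?case
    by (intro exI[of _ "\<lambda>t. F' t + G' t"])
      (auto intro: derivative_product_sum.sum has_vector_derivative_add)
qed

lemma smooth_curve_bilinear:
  assumes "bounded_bilinear p" "smooth_curve f" "smooth_curve g"
  shows "smooth_curve (\<lambda>t. p (f t) (g t))"
proof -
  have mem: "derivative_product_sum p f g (curve_deriv k (\<lambda>t. p (f t) (g t)))" for k
  proof (induction k)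
    case 0
    show ?case using derivative_product_sum.product[of p f g 0 0] by simp
  next
    case (Suc k)
    then obtain F' where "derivative_product_sum p f g F'"
      "\<And>t. (curve_deriv k (\<lambda>t. p (f t) (g t)) has_vector_derivative F' t) (at t)"
      using derivative_product_sum_has_derivative[OF assms] by blast
    moreover from this(2) have "curve_deriv (Suc k) (\<lambda>t. p (f t) (g t)) = F'"
      by (simp add: fun_eq_iff curve_deriv_Suc vector_derivative_at)
    ultimately show ?case by simp
  qed
  show ?thesis
    unfolding smooth_curve_def differentiable_on_def
    using derivative_product_sum_has_derivative[OF assms mem]
    by (metis UNIV_I differentiableI_vector)
qed

lemma smooth_curve_deriv:
  assumes "smooth_curve f"
  shows "smooth_curve (curve_deriv 1 f)"
  using smooth_curveI_seq(1)[where G = "\<lambda>k. curve_deriv (Suc k) f"] smooth_curve_has_deriv[OF assms]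
  by simp

lemma smooth_curve_bounded_linear:
  assumes "bounded_linear L" "smooth_curve f"
  shows "smooth_curve (\<lambda>t. L (f t))"
  by (rule smooth_curveI_seq(1)[where G = "\<lambda>k t. L (curve_deriv k f t)"])
    (auto intro: bounded_linear.has_vector_derivative[OF assms(1)] smooth_curve_has_deriv[OF assms(2)])

lemma curve_deriv_periodic:
  assumes "smooth_curve f" "\<And>t. f (t + c) = f t"
  shows "curve_deriv 1 f (t + c) = curve_deriv 1 f t"
proof -
  have "(f has_vector_derivative curve_deriv 1 f (t + c)) (at (t + c))"
    using smooth_curve_has_deriv[OF assms(1), of 0 "t + c"] by simp
  then have "((f \<circ> (\<lambda>t. t + c)) has_vector_derivative 1 *\<^sub>R curve_deriv 1 f (t + c)) (at t)"
    by (intro vector_diff_chain_at) (auto intro!: derivative_eq_intros)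
  moreover have "f \<circ> (\<lambda>t. t + c) = f" using assms(2) by auto
  ultimately show ?thesis
    using smooth_curve_has_deriv[OF assms(1), of 0 t]
    by (auto dest: vector_derivative_unique_at)
qed

lift_definition velocity :: "'a::real_normed_vector loop \<Rightarrow> 'a loop" is "curve_deriv 1"
  using smooth_curve_deriv curve_deriv_periodic by blast

lift_definition scale_by :: "real loop \<Rightarrow> 'a::real_normed_vector loop \<Rightarrow> 'a loop"
  is "\<lambda>b u t. b t *\<^sub>R u t"
  by (auto intro: smooth_curve_bilinear[OF bounded_bilinear_scaleR])

text \<open>The clockwise quarter turn, which converts the area form into the inner product.\<close>

definition quarter_turn :: "real^2 \<Rightarrow> real^2" where
  "quarter_turn x = vector [x $ 2, - x $ 1]"

lemma area_form_quarter_turn: "area_form (quarter_turn x) y = x \<bullet> y"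
  by (simp add: area_form_def quarter_turn_def inner_vec_def sum_2 vector_2)

lemma bounded_linear_quarter_turn: "bounded_linear quarter_turn"
  by (intro linear_conv_bounded_linear[THEN iffD1] linearI)
    (auto simp: quarter_turn_def vec_eq_iff forall_2 vector_2)

lift_definition turn :: "(real^2) loop \<Rightarrow> (real^2) loop" is "\<lambda>u t. quarter_turn (u t)"
  by (auto intro: smooth_curve_bounded_linear[OF bounded_linear_quarter_turn])

lemma velocity_at_angle: "at_angle (velocity f) t = loop_deriv 1 f t"
  by (simp add: velocity.rep_eq loop_deriv_def)

lemma loop_has_derivative: "(at_angle f has_vector_derivative loop_deriv 1 f t) (at t)"
  using at_angle[of f] smooth_curve_has_deriv[of "at_angle f" 0 t] by (simp add: loop_deriv_def)

lemma continuous_on_loop [continuous_intros]: "continuous_on S (at_angle f)"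
  by (meson continuous_at_imp_continuous_on has_vector_derivative_continuous loop_has_derivative)

lemma loop_reduce_angle: "\<exists>s\<in>{0..2 * pi}. at_angle f t = at_angle f s"
proof -
  interpret periodic_fun_simple "at_angle f" "2 * pi"
    using at_angle[of f] by unfold_locales auto
  define n where "n = \<lfloor>t / (2 * pi)\<rfloor>"
  have "real_of_int n \<le> t / (2 * pi)" "t / (2 * pi) \<le> real_of_int n + 1"
    unfolding n_def by linarith+
  then have "t - of_int n * (2 * pi) \<in> {0..2 * pi}"
    by (simp add: field_simps)
  then show ?thesis
    using minus_of_int[of t n] by metis
qed

lemma loop_eq_0_iff: "f = 0 \<longleftrightarrow> (\<forall>t. at_angle f t = 0)"
  by transfer auto

section \<open>Continuity and smoothness of the weighted form\<close>

text \<open>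
  The weighted form only involves the values of its arguments, so it factors through the inclusion of
  the loops into the Banach space of bounded continuous functions, where a norm estimate suffices.
\<close>

lemma loop_bcontfun: "at_angle f \<in> bcontfun"
proof -
  have "range (at_angle f) \<subseteq> at_angle f ` {0..2 * pi}"
    using loop_reduce_angle[of f] by fastforce
  moreover have "bounded (at_angle f ` {0..2 * pi})"
    by (intro compact_imp_bounded compact_continuous_image continuous_intros) auto
  ultimately show ?thesis
    by (auto simp: bcontfun_def continuous_on_loop intro: bounded_subset)
qed

definition bounded_function :: "'a::real_normed_vector loop \<Rightarrow> real \<Rightarrow>\<^sub>C 'a" where
  "bounded_function f = Bcontfun (at_angle f)"

lemma bounded_function_apply: "apply_bcontfun (bounded_function f) = at_angle f"
  by (simp add: bounded_function_def Bcontfun_inverse loop_bcontfun)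

lemma continuous_bounded_function:
  "continuous_on S (bounded_function :: 'a::real_normed_vector loop \<Rightarrow> _)"
proof -
  have "open (bounded_function -` V)" if V: "open V" for V :: "(real \<Rightarrow>\<^sub>C 'a) set"
    unfolding open_loop_def
  proof
    fix f :: "'a loop" assume "f \<in> bounded_function -` V"
    then obtain e where e: "e > 0" "ball (bounded_function f) e \<subseteq> V"
      using V open_contains_ball by blast
    have "bounded_function g \<in> V"
      if *: "\<forall>j\<le>0. \<forall>t. norm (loop_deriv j g t - loop_deriv j f t) \<le> e / 2" for g
    proof -
      have "dist (bounded_function f) (bounded_function g) \<le> e / 2"
        using * by (intro dist_bound)
          (simp add: bounded_function_apply loop_deriv_def dist_norm norm_minus_commute)
      then show ?thesis using e by (auto simp: subset_eq)
    qed
    then show "\<exists>k. \<exists>d>0. \<forall>g. (\<forall>j\<le>k. \<forall>t. norm (loop_deriv j g t - loop_deriv j f t) \<le> d)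
        \<longrightarrow> g \<in> bounded_function -` V"
      using e(1) by (intro exI[of _ 0] exI[of _ "e / 2"]) auto
  qed
  then have "continuous_on UNIV (bounded_function :: 'a loop \<Rightarrow> _)"
    by (simp add: continuous_on_open_vimage)
  then show ?thesis by (rule continuous_on_subset) simp
qed

lemma linear_bounded_function: "linear bounded_function"
  by (intro linearI bcontfun_eqI)
    (simp_all add: bounded_function_apply plus_loop.rep_eq scaleR_loop.rep_eq)

lemma bounded_bilinear_area_form: "bounded_bilinear area_form"
proof -
  have eq: "area_form = (\<lambda>x y. (- quarter_turn x) \<bullet> y)"
    by (simp add: fun_eq_iff area_form_def quarter_turn_def inner_vec_def sum_2 vector_2)
  show ?thesis
    unfolding eq
    by (rule bounded_bilinear.comp1[OF bounded_bilinear_inner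
          bounded_linear_minus[OF bounded_linear_quarter_turn]])
qed

definition weighted_area ::
    "real loop \<Rightarrow> (real \<Rightarrow>\<^sub>C (real^2)) \<Rightarrow> (real \<Rightarrow>\<^sub>C (real^2)) \<Rightarrow> real" where
  "weighted_area b \<phi> \<psi> = integral {0..2 * pi} (\<lambda>t. area_form (\<phi> t) (\<psi> t) * at_angle b t)"

lemma bounded_bilinear_weighted_area: "bounded_bilinear (weighted_area b)"
proof -
  interpret area: bounded_bilinear area_form by (rule bounded_bilinear_area_form)
  have cont: "continuous_on S (\<lambda>t. area_form (\<phi> t) (\<psi> t) * at_angle b t)"
    for S and \<phi> \<psi> :: "real \<Rightarrow>\<^sub>C (real^2)"
    by (intro continuous_intros area.continuous_on continuous_on_apply_bcontfun)
  note int = integrable_continuous_real[OF cont]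
  obtain K where K: "K > 0" "\<And>x y. norm (area_form x y) \<le> norm x * norm y * K"
    using area.pos_bounded by blast
  have bound: "norm (weighted_area b \<phi> \<psi>)
      \<le> norm \<phi> * norm \<psi> * (K * integral {0..2 * pi} (\<lambda>t. \<bar>at_angle b t\<bar>))"
    for \<phi> \<psi> :: "real \<Rightarrow>\<^sub>C (real^2)"
  proof -
    have "norm (area_form (\<phi> t) (\<psi> t) * at_angle b t)
        \<le> norm \<phi> * norm \<psi> * K * \<bar>at_angle b t\<bar>" for t
    proof -
      have "norm (area_form (\<phi> t) (\<psi> t)) \<le> norm (\<phi> t) * norm (\<psi> t) * K"
        by (rule K)
      also have "\<dots> \<le> norm \<phi> * norm \<psi> * K"
        using K(1) by (intro mult_right_mono mult_mono norm_bounded) auto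
      finally show ?thesis by (simp add: abs_mult mult_right_mono)
    qed
    then have "norm (integral {0..2 * pi} (\<lambda>t. area_form (\<phi> t) (\<psi> t) * at_angle b t))
        \<le> integral {0..2 * pi} (\<lambda>t. norm \<phi> * norm \<psi> * K * \<bar>at_angle b t\<bar>)"
      by (intro integral_norm_bound_integral int)
        (auto intro!: integrable_continuous_real continuous_intros)
    then show ?thesis by (simp add: weighted_area_def mult.assoc)
  qed
  show ?thesis
  proof
    show "\<exists>K. \<forall>\<phi> \<psi>. norm (weighted_area b \<phi> \<psi>) \<le> norm \<phi> * norm \<psi> * K"
      using bound by blast
  qed (simp_all add: weighted_area_def area.add_left area.add_right area.scaleR_left area.scaleR_right
      plus_bcontfun.rep_eq scaleR_bcontfun.rep_eq distrib_right mult.assoc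
      integral_add[OF int int, simplified])
qed

lemma weighted_form_factorization:
  "weighted_form b f u v = weighted_area b (bounded_function u) (bounded_function v)"
  by (simp add: weighted_area_def weighted_form_def circle_integral_def bounded_function_apply)

lemma bilinear_weighted_form: "bilinear (weighted_form b f)"
proof -
  interpret bounded_bilinear "weighted_area b"
    by (rule bounded_bilinear_weighted_area)
  show ?thesis
    by (auto intro!: linearI simp: bilinear_def weighted_form_factorization add_left add_right
        scaleR_left scaleR_right linear_add[OF linear_bounded_function]
        linear_scale[OF linear_bounded_function])
qed

lemma continuous_on_weighted_form:
  assumes "continuous_on S u" "continuous_on S v"
  shows "continuous_on S (\<lambda>x. weighted_form b f (u x) (v x))"
  unfolding weighted_form_factorization
  by (intro bounded_bilinear.continuous_on[OF bounded_bilinear_weighted_area]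
      continuous_on_compose2[OF continuous_bounded_function[of UNIV]] assms) auto

lemma weighted_form_alternating: "weighted_form b f u u = 0"
  by (simp add: weighted_form_def circle_integral_def area_form_def)

lemma weighted_form_skew: "weighted_form b f v u = - weighted_form b f u v"
  unfolding weighted_form_def circle_integral_def integral_neg[symmetric]
  by (simp add: area_form_def algebra_simps)

text \<open>
  The derivatives are \<open>D\<^sup>1(x){h\<^sub>0} = C(x, h\<^sub>0) + C(h\<^sub>0, x)\<close> and
  \<open>D\<^sup>2(x){h\<^sub>0, h\<^sub>1} = C(h\<^sub>1, h\<^sub>0) + C(h\<^sub>0, h\<^sub>1)\<close>, and all later ones vanish.
\<close>

lemma smooth_fun_on_quadratic:
  fixes C :: "'e::{real_vector,topological_space} \<Rightarrow> 'e \<Rightarrow> real"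
  assumes C: "bilinear C"
    and cont: "\<And>(S :: ('e \<times> (nat \<Rightarrow> 'e)) set) u v. continuous_on S u \<Longrightarrow> continuous_on S v \<Longrightarrow>
      continuous_on S (\<lambda>z. C (u z) (v z))"
  shows "smooth_fun_on UNIV (\<lambda>x. C x x)"
proof -
  define D where "D k x h = (if k = 0 then C x x else if k = 1 then C x (h 0) + C (h 0) x
      else if k = 2 then C (h 1) (h 0) + C (h 0) (h 1) else 0)"
    for k :: nat and x and h :: "nat \<Rightarrow> 'e"
  note C_simps = bilinear_ladd[OF C] bilinear_radd[OF C] bilinear_lmul[OF C] bilinear_rmul[OF C]
  have deriv: "((\<lambda>s. D k (x + s *\<^sub>R h k) h) has_real_derivative D (Suc k) x h) (at 0)"
    for k x h
  proof -
    have "D k (x + s *\<^sub>R h k) h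
        = D k x h + s * D (Suc k) x h + s\<^sup>2 * (if k = 0 then C (h 0) (h 0) else 0)" for s
      by (auto simp: D_def C_simps algebra_simps power2_eq_square numeral_2_eq_2)
    then show ?thesis by (auto intro!: derivative_eq_intros)
  qed
  have iter: "iter_dir_deriv k (\<lambda>x. C x x) = D k" for k
  proof (induction k)
    case 0
    show ?case by (simp add: fun_eq_iff D_def)
  next
    case (Suc k)
    then show ?case by (simp add: fun_eq_iff dir_deriv_def DERIV_imp_deriv[OF deriv])
  qed
  have "continuous_on UNIV (\<lambda>z. D k (fst z) (snd z))" for k
  proof -
    have h: "continuous_on UNIV (\<lambda>z :: 'e \<times> (nat \<Rightarrow> 'e). snd z i)" for i
      by (rule continuous_on_compose2[OF continuous_on_product_coordinates
            continuous_on_snd[OF continuous_on_id]]) simp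
    have x: "continuous_on UNIV (fst :: 'e \<times> (nat \<Rightarrow> 'e) \<Rightarrow> 'e)"
      by (rule continuous_on_fst[OF continuous_on_id])
    consider "k = 0" | "k = 1" | "k = 2" | "k > 2" by linarith
    then show ?thesis
      by cases (simp_all add: D_def continuous_on_add cont h x)
  qed
  moreover have "(\<lambda>s. D k (x + s *\<^sub>R h k) h) differentiable at 0" for k x h
    using deriv real_differentiable_def by blast
  ultimately show ?thesis
    by (simp add: smooth_fun_on_def iter case_prod_unfold)
qed

lemma two_form_on_weighted_form: "two_form_on UNIV (weighted_form b)"
proof -
  (* The first components of the triples are base points, on which the weighted form does not
     depend; 0 stands for any of them. *)
  define C where "C x y = weighted_form b 0 (fst (snd x)) (snd (snd y))"
    for x y :: "(real^2) loop \<times> (real^2) loop \<times> (real^2) loop"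
  have "bilinear C"
    by (auto intro!: linearI simp: bilinear_def C_def bilinear_ladd[OF bilinear_weighted_form]
      bilinear_radd[OF bilinear_weighted_form] bilinear_lmul[OF bilinear_weighted_form]
      bilinear_rmul[OF bilinear_weighted_form])
  then have "smooth_fun_on UNIV (\<lambda>x. C x x)"
    by (rule smooth_fun_on_quadratic)
      (auto simp: C_def intro!: continuous_on_weighted_form continuous_intros)
  moreover have "(\<lambda>x. C x x) = (\<lambda>(x, u, v). weighted_form b x u v)"
    by (auto simp: C_def weighted_form_def)
  ultimately show ?thesis
    by (simp add: two_form_on_def bilinear_weighted_form weighted_form_alternating)
qed

lemma one_form_on_primitive: "one_form_on UNIV (\<lambda>f u. weighted_form b f f u / 2)"
proof -
  define C where "C x y = weighted_form b 0 (fst x) (snd y) / 2"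
    for x y :: "(real^2) loop \<times> (real^2) loop"
  have "bilinear C"
    by (auto intro!: linearI simp: bilinear_def C_def bilinear_ladd[OF bilinear_weighted_form]
      bilinear_radd[OF bilinear_weighted_form] bilinear_lmul[OF bilinear_weighted_form]
      bilinear_rmul[OF bilinear_weighted_form] add_divide_distrib)
  then have "smooth_fun_on UNIV (\<lambda>x. C x x)"
    by (rule smooth_fun_on_quadratic)
      (auto simp: C_def intro!: continuous_on_weighted_form continuous_intros)
  moreover have "(\<lambda>x. C x x) = (\<lambda>(f, u). weighted_form b f f u / 2)"
    by (auto simp: C_def weighted_form_def)
  moreover have "linear (\<lambda>u. weighted_form b f f u / 2)" for f
    by (auto intro!: linearI simp: add_divide_distrib
      bilinear_radd[OF bilinear_weighted_form] bilinear_rmul[OF bilinear_weighted_form])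
  ultimately show ?thesis
    by (simp add: one_form_on_def)
qed

lemma ext_deriv1_primitive:
  "ext_deriv1 (\<lambda>f u. weighted_form b f f u / 2) f u v = weighted_form b f u v"
proof -
  have deriv: "dir_deriv (\<lambda>g. weighted_form b g g v / 2) f u = weighted_form b f u v / 2" for u v
  proof -
    have affine: "weighted_form b (f + s *\<^sub>R u) (f + s *\<^sub>R u) v / 2
        = weighted_form b f f v / 2 + s * (weighted_form b f u v / 2)" for s
    proof -
      have "weighted_form b (f + s *\<^sub>R u) = weighted_form b f"
        by (simp add: weighted_form_def fun_eq_iff)
      then show ?thesis
        by (simp add: bilinear_ladd[OF bilinear_weighted_form] bilinear_lmul[OF bilinear_weighted_form]
            add_divide_distrib)
    qed
    show ?thesis
      unfolding dir_deriv_def affine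
      by (rule DERIV_imp_deriv) (auto intro!: derivative_eq_intros)
  qed
  show ?thesis
    by (simp add: ext_deriv1_def deriv weighted_form_skew[of b f v u])
qed

lemma ext_deriv2_weighted_form: "ext_deriv2 (weighted_form b) f u v w = 0"
  by (simp add: ext_deriv2_def dir_deriv_def weighted_form_def)

section \<open>Nondegeneracy\<close>

lemma integral_norm_square_eq_0:
  fixes w :: "(real^2) loop"
  assumes "circle_integral (\<lambda>t. at_angle w t \<bullet> at_angle w t) = 0"
  shows "w = 0"
proof -
  have "\<forall>t\<in>{0..2 * pi}. at_angle w t \<bullet> at_angle w t = 0"
    using assms unfolding circle_integral_def
    by (subst (asm) integral_eq_0_iff) (simp_all add: continuous_on_inner continuous_on_loop)
  then show ?thesis
    unfolding loop_eq_0_iff using loop_reduce_angle[of w] by (metis inner_eq_zero_iff)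
qed

text \<open>
  Let \<open>w\<close> be the part of \<open>g\<close> that is \<open>L\<^sup>2\<close>-orthogonal to \<open>k\<close>.  Pairing with the quarter turn of
  \<open>w\<close> by the area form is pairing with \<open>w\<close> by the inner product, so this turned loop is an
  admissible \<open>v\<close>, and the hypothesis makes \<open>w\<close> orthogonal to \<open>g\<close> as well, hence to itself.
\<close>

lemma lagrange_multiplier:
  fixes g k :: "(real^2) loop"
  assumes test: "\<And>v. circle_integral (\<lambda>t. area_form (at_angle v t) (at_angle k t)) = 0 \<Longrightarrow>
    circle_integral (\<lambda>t. area_form (at_angle v t) (at_angle g t)) = 0"
  shows "\<exists>c. g = c *\<^sub>R k"
proof -
  define ip where "ip u v = circle_integral (\<lambda>t. at_angle u t \<bullet> at_angle v t)"
    for u v :: "(real^2) loop"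
  have ip_comm: "ip u v = ip v u" for u v
    by (simp add: ip_def inner_commute)
  have ip_diff: "ip (u - c *\<^sub>R v) x = ip u x - c * ip v x" for u v x c
  proof -
    have "continuous_on {0..2 * pi} (\<lambda>t. at_angle u t \<bullet> at_angle v t)" for u v :: "(real^2) loop"
      by (intro continuous_intros)
    note int = integrable_continuous_real[OF this]
    show ?thesis
      using integral_diff[OF int[of u x] integrable_on_mult_right[OF int[of v x], of c]]
      by (simp add: ip_def circle_integral_def minus_loop.rep_eq scaleR_loop.rep_eq inner_diff_left)
  qed
  have ip_turn: "circle_integral (\<lambda>t. area_form (at_angle (turn w) t) (at_angle x t)) = ip w x"
    for w x
    by (simp add: ip_def turn.rep_eq area_form_quarter_turn)
  define c where "c = ip g k / ip k k"
  define w where "w = g - c *\<^sub>R k"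
  have wk: "ip w k = 0"
  proof (cases "ip k k = 0")
    case True
    then have "k = 0" unfolding ip_def by (rule integral_norm_square_eq_0)
    then show ?thesis by (simp add: ip_def circle_integral_def zero_loop.rep_eq)
  qed (simp add: w_def ip_diff c_def)
  then have wg: "ip w g = 0"
    using test[of "turn w"] by (simp add: ip_turn)
  have "ip w w = ip g w - c * ip k w"
    by (simp add: w_def ip_diff)
  then have "ip w w = 0"
    using wk wg by (simp add: ip_comm)
  then have "w = 0" unfolding ip_def by (rule integral_norm_square_eq_0)
  then show ?thesis by (auto simp: w_def)
qed

text \<open>Differentiating \<open>b u = 0\<close> at a zero of \<open>b\<close> gives \<open>b' u = 0\<close> there.\<close>

lemma scale_by_eq_0:
  assumes "nondegenerate_zeros b" "scale_by b u = 0"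
  shows "u = 0"
proof -
  have bu: "at_angle b t *\<^sub>R at_angle u t = 0" for t
    using assms(2) by (simp add: loop_eq_0_iff scale_by.rep_eq)
  have "at_angle u t = 0" for t
  proof (cases "at_angle b t = 0")
    case True
    have "((\<lambda>t. at_angle b t *\<^sub>R at_angle u t) has_vector_derivative
        at_angle b t *\<^sub>R loop_deriv 1 u t + loop_deriv 1 b t *\<^sub>R at_angle u t) (at t)"
      by (intro bounded_bilinear.has_vector_derivative[OF bounded_bilinear_scaleR] loop_has_derivative)
    then have "loop_deriv 1 b t *\<^sub>R at_angle u t = 0"
      using True vector_derivative_unique_at[OF _ has_vector_derivative_const[of 0]]
      by (force simp: bu)
    then show ?thesis
      using True assms(1) by (auto simp: nondegenerate_zeros_def)
  qed (use bu[of t] in auto)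
  then show ?thesis by (simp add: loop_eq_0_iff)
qed

lemma weighted_form_nondegenerate:
  assumes b: "nondegenerate_zeros b" "at_angle b t\<^sub>0 = 0"
    and f: "\<And>t. loop_deriv 1 f t \<noteq> 0"
    and u: "\<And>v. v \<in> Emb_tangent f \<Longrightarrow> weighted_form b f u v = 0"
  shows "u = 0"
proof -
  have "circle_integral (\<lambda>t. area_form (at_angle v t) (at_angle (scale_by b u) t))
      = weighted_form b f v u" for v
    by (simp add: weighted_form_def scale_by.rep_eq area_form_def algebra_simps)
  then obtain c where c: "scale_by b u = c *\<^sub>R velocity f"
    using lagrange_multiplier[of "velocity f" "scale_by b u"] u
    by (auto simp: Emb_tangent_def velocity_at_angle weighted_form_skew[of b f _ u])
  have "c *\<^sub>R loop_deriv 1 f t\<^sub>0 = at_angle b t\<^sub>0 *\<^sub>R at_angle u t\<^sub>0"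
    using arg_cong[OF c, of "\<lambda>x. at_angle x t\<^sub>0"]
    by (simp add: scale_by.rep_eq scaleR_loop.rep_eq velocity_at_angle)
  then have "c = 0" using b(2) f by simp
  then show ?thesis using scale_by_eq_0[OF b(1)] c by simp
qed

section \<open>The weighted form is symplectic and exact\<close>

theorem proposition3p2:
  fixes b :: "real loop" and a :: real
  assumes "nondegenerate_zeros b"
    and "{t. at_angle b t = 0} \<noteq> {}"
    and "a \<noteq> 0"
  shows "symplectic_form (Emb a) Emb_tangent (weighted_form b)
       \<and> exact_two_form (Emb a) Emb_tangent (weighted_form b)"
proof -
  let ?M = "Emb a" and ?T = Emb_tangent and ?\<Omega> = "weighted_form b"
  let ?\<Theta> = "\<lambda>f u. weighted_form b f f u / 2"
  have ext2: "extends_two_form ?M ?T ?\<Omega> UNIV ?\<Omega>"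
    by (simp add: extends_two_form_def two_form_on_weighted_form)
  have ext1: "extends_one_form ?M ?T ?\<Theta> UNIV ?\<Theta>"
    by (simp add: extends_one_form_def one_form_on_primitive)
  have "is_two_form ?M ?T ?\<Omega>"
    unfolding is_two_form_def using ext2 by blast
  moreover have "is_one_form ?M ?T ?\<Theta>"
    unfolding is_one_form_def using ext1 by blast
  moreover have "has_ext_deriv2 ?M ?T ?\<Omega> (\<lambda>_ _ _ _. 0)"
    unfolding has_ext_deriv2_def using ext2 ext_deriv2_weighted_form
    by (metis UNIV_I)
  moreover have "has_ext_deriv1 ?M ?T ?\<Theta> ?\<Omega>"
    unfolding has_ext_deriv1_def using ext1 ext_deriv1_primitive
    by (metis (no_types, lifting) UNIV_I)
  moreover have "weakly_nondegenerate ?M ?T ?\<Omega>"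
    unfolding weakly_nondegenerate_def Emb_def is_embedding_def
    using assms(1,2) weighted_form_nondegenerate by blast
  ultimately show ?thesis
    unfolding symplectic_form_def closed_two_form_def exact_two_form_def by blast
qed

end
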